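(* Let $d$ be a metric on $\mathcal X$ such that $(\mathcal X,d)$ is a Polish space. Let $\mu\in\mathcal P(\mathcal X)$ be such that $\int_{\mathcal X}d(x_o,x)\,\mu(dx)<+\infty$ for all $x_o\in\mathcal X$, and suppose that $$\alpha(\mathcal T_d(\mu,\nu))\le H(\nu\mid\mu)\quad\forall\nu\in\mathcal P(\mathcal X)$$ holds with an unbounded $\alpha\in\mathcal C$. Then for all measurable $A\subset\mathcal X$ with $\mu(A)>0$, $$\mu(A^r)\ge1-e^{-\alpha(r-r_A)}\quad\forall r\ge r_A,$$ where $r_A:=\alpha^{-1}(-\log\mu(A))$.
   Context: $\mathcal P(\mathcal X)$ is the set of Borel probability measures on $\mathcal X$. $A^r=\{x\in\mathcal X:d(x,A)\le r\}$. $\mathcal T_d(\mu,\nu)=\inf_\pi\int d(x,y)\,\pi(dx\,dy)\in[0,\infty]$, the infimum over all probability measures $\pi$ on $\mathcal X\times\mathcal X$ with first marginal $\mu$ and second marginal $\nu$. $H(\nu\mid\mu)=\int\log\frac{d\nu}{d\mu}\,d\nu$ if $\nu\ll\mu$ and $+\infty$ otherwise. $\mathcal C$ is the class of all functions $\alpha$ on $[0,\infty)$ with values in $[0,\infty]$ that are convex, increasing (meaning nondecreasing), left continuous, with $\alpha(0)=0$; one sets $\alpha(+\infty)=\lim_{t\to\infty}\alpha(t)$. For unbounded $\alpha\in\mathcal C$ and $u\ge0$, $\alpha^{-1}(u)=\sup\{t\ge0:\alpha(t)\le u\}$. *)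

theory Defs
  imports "HOL-Probability.Probability"
begin

definition borel_probs :: "'a::topological_space measure set" where
  "borel_probs = {\<mu>. prob_space \<mu> \<and> sets \<mu> = sets borel}"

definition couplings ::
    "'a::topological_space measure \<Rightarrow> 'a measure \<Rightarrow> ('a \<times> 'a) measure set" where
  "couplings \<mu> \<nu> = {\<pi> \<in> borel_probs. distr \<pi> borel fst = \<mu> \<and> distr \<pi> borel snd = \<nu>}"

definition transport_cost :: "'a::metric_space measure \<Rightarrow> 'a measure \<Rightarrow> ennreal" where
  "transport_cost \<mu> \<nu> = (INF \<pi>\<in>couplings \<mu> \<nu>. \<integral>\<^sup>+z. ennreal (dist (fst z) (snd z)) \<partial>\<pi>)"

text \<open>
  \<open>rel_entropy \<nu> \<mu>\<close> is $H(\nu\mid\mu)$. The extended integral of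
  $\log(d\nu/d\mu)$ against $\nu$ is the difference of the integrals of its positive and negative
  parts, since \<open>ennreal\<close> sends negative reals to 0. For probability measures the negative
  part always has a finite integral, so the subtraction is never $\infty-\infty$. The values of
  \<open>RN_deriv\<close> at which \<open>ln\<close> or \<open>enn2real\<close> takes a junk value (0 and $\infty$) form
  a $\nu$-null set.
\<close>

definition rel_entropy :: "'a measure \<Rightarrow> 'a measure \<Rightarrow> ereal" where
  "rel_entropy \<nu> \<mu> =
     (if absolutely_continuous \<mu> \<nu>
      then enn2ereal (\<integral>\<^sup>+x. ennreal (ln (enn2real (RN_deriv \<mu> \<nu> x))) \<partial>\<nu>)
         - enn2ereal (\<integral>\<^sup>+x. ennreal (- ln (enn2real (RN_deriv \<mu> \<nu> x))) \<partial>\<nu>)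
      else \<infinity>)"

text \<open>
  A function on $[0,\infty)$ with values in $[0,\infty]$ is a \<open>real \<Rightarrow> ennreal\<close> whose
  values at negative arguments are never used. In the convexity condition $0\cdot\infty=0$.
\<close>

definition class_C :: "(real \<Rightarrow> ennreal) set" where
  "class_C = {\<alpha>.
     (\<forall>s\<ge>0. \<forall>t\<ge>0. \<forall>c\<in>{0..1}.
        \<alpha> ((1 - c) * s + c * t) \<le> ennreal (1 - c) * \<alpha> s + ennreal c * \<alpha> t) \<and>
     mono_on {0..} \<alpha> \<and>
     (\<forall>t>0. continuous (at_left t) \<alpha>) \<and>
     \<alpha> 0 = 0}"

definition unbounded :: "(real \<Rightarrow> ennreal) \<Rightarrow> bool" where
  "unbounded \<alpha> \<longleftrightarrow> (\<forall>M::real. \<exists>t\<ge>0. \<alpha> t > ennreal M)"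

text \<open>The extension of \<open>\<alpha>\<close> to $[0,\infty]$ by its limit at infinity.\<close>

definition extend :: "(real \<Rightarrow> ennreal) \<Rightarrow> ennreal \<Rightarrow> ennreal" where
  "extend \<alpha> s = (if s = \<infinity> then Lim at_top \<alpha> else \<alpha> (enn2real s))"

text \<open>
  For $u\ge0$ and unbounded \<open>\<alpha>\<close> in \<open>class_C\<close> the set below is nonempty and bounded
  above, so its real supremum is the true one.
\<close>

definition gen_inverse :: "(real \<Rightarrow> ennreal) \<Rightarrow> real \<Rightarrow> real" where
  "gen_inverse \<alpha> u = Sup {t. 0 \<le> t \<and> \<alpha> t \<le> ennreal u}"

text \<open>$e^{-u}$ for $u\in[0,\infty]$.\<close>

definition exp_neg :: "ennreal \<Rightarrow> real" where
  "exp_neg u = (if u = \<infinity> then 0 else exp (- enn2real u))"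

text \<open>\<open>infdist\<close> is the distance to a set only when the set is nonempty.\<close>

definition enlargement :: "'a::metric_space set \<Rightarrow> real \<Rightarrow> 'a set" where
  "enlargement A r = {x. infdist x A \<le> r}"

end

theory Submission
  imports Defs
begin

text \<open>
  A transport-entropy inequality becomes a statement about sets by testing it on the conditional
  measures \<open>\<mu>(\<cdot> | C)\<close>, whose entropy relative to \<open>\<mu>\<close> is exactly \<open>- ln \<mu>(C)\<close>
  (\<open>rel_entropy_uniform_measure\<close>). It is applied with \<open>C = A\<close> and with \<open>C = B\<close>, the complement
  of the enlargement \<open>A\<^sup>r\<close>; if \<open>B\<close> is a null set there is nothing to prove.

  Marton's classical argument combines the two through the triangle inequality for the transport
  cost, which rests on gluing couplings. Here the easy half of Kantorovich duality does the same
  work: a nonnegative 1-Lipschitz function \<open>f\<close> satisfies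
  \<open>\<integral> f d\<nu> \<le> \<integral> f d\<mu> + T(\<mu>, \<nu>)\<close> and \<open>\<integral> f d\<mu> \<le> \<integral> f d\<nu> + T(\<mu>, \<nu>)\<close>
  (\<open>nn_integral_Lipschitz_le_transport_cost\<close>). Let \<open>f\<close> be the distance to \<open>A\<close> and
  \<open>m = \<integral> f d\<mu>\<close>, which is finite because \<open>\<mu>\<close> has a first moment. As \<open>f\<close> vanishes on \<open>A\<close>,
  the cost of moving \<open>\<mu>\<close> to \<open>\<mu>(\<cdot> | A)\<close> is at least \<open>m\<close>, so \<open>\<alpha>(m) \<le> - ln \<mu>(A)\<close>, and hence
  \<open>m \<le> r\<^sub>A\<close>. As \<open>f > r\<close> on \<open>B\<close>, the cost of moving \<open>\<mu>\<close> to \<open>\<mu>(\<cdot> | B)\<close> is at least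
  \<open>r - m \<ge> r - r\<^sub>A\<close>, so \<open>\<alpha>(r - r\<^sub>A) \<le> - ln \<mu>(B)\<close>, which is the claim.
\<close>

section \<open>Lipschitz functions and the transport cost\<close>

text \<open>
  Integrate \<open>f y \<le> f x + dist x y\<close> and \<open>f x \<le> f y + dist x y\<close> against a coupling and take the
  infimum over all couplings. This is the easy half of Kantorovich duality.
\<close>

lemma nn_integral_Lipschitz_le_transport_cost:
  fixes \<mu> \<nu> :: "'a::metric_space measure" and f :: "'a \<Rightarrow> real"
  assumes lip: "1-lipschitz_on UNIV f" and nonneg: "\<And>x. 0 \<le> f x"
  shows "(\<integral>\<^sup>+y. ennreal (f y) \<partial>\<nu>) \<le> (\<integral>\<^sup>+x. ennreal (f x) \<partial>\<mu>) + transport_cost \<mu> \<nu>"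
    and "(\<integral>\<^sup>+x. ennreal (f x) \<partial>\<mu>) \<le> (\<integral>\<^sup>+y. ennreal (f y) \<partial>\<nu>) + transport_cost \<mu> \<nu>"
proof -
  have f_step: "f y \<le> f x + dist x y" "f x \<le> f y + dist x y" for x y
    using lipschitz_onD[OF lip, of x y] by (simp_all add: dist_real_def)
  have [measurable]: "f \<in> borel_measurable borel"
    using lipschitz_on_continuous_on[OF lip] by (rule borel_measurable_continuous_onI)
  have coupling: "(\<integral>\<^sup>+y. ennreal (f y) \<partial>\<nu>) \<le> (\<integral>\<^sup>+x. ennreal (f x) \<partial>\<mu>)
            + (\<integral>\<^sup>+z. ennreal (dist (fst z) (snd z)) \<partial>\<pi>) \<and>
        (\<integral>\<^sup>+x. ennreal (f x) \<partial>\<mu>) \<le> (\<integral>\<^sup>+y. ennreal (f y) \<partial>\<nu>)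
            + (\<integral>\<^sup>+z. ennreal (dist (fst z) (snd z)) \<partial>\<pi>)"
    if \<pi>: "\<pi> \<in> couplings \<mu> \<nu>" for \<pi>
  proof -
    have sets_\<pi>: "sets \<pi> = sets borel"
      and marginals: "distr \<pi> borel fst = \<mu>" "distr \<pi> borel snd = \<nu>"
      using \<pi> by (auto simp: couplings_def borel_probs_def)
    have meas: "g \<in> borel_measurable \<pi>" if "continuous_on UNIV g"
      for g :: "'a \<times> 'a \<Rightarrow> 'b::topological_space"
      using borel_measurable_continuous_onI[OF that]
      by (simp add: measurable_cong_sets[OF sets_\<pi> refl])
    have [measurable]: "fst \<in> measurable \<pi> (borel :: 'a measure)"
      "snd \<in> measurable \<pi> (borel :: 'a measure)"
      "(\<lambda>z. dist (fst z) (snd z)) \<in> borel_measurable \<pi>"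
      by (auto intro!: meas continuous_intros)
    have push: "(\<integral>\<^sup>+x. ennreal (f x) \<partial>\<mu>) = (\<integral>\<^sup>+z. ennreal (f (fst z)) \<partial>\<pi>)"
      "(\<integral>\<^sup>+y. ennreal (f y) \<partial>\<nu>) = (\<integral>\<^sup>+z. ennreal (f (snd z)) \<partial>\<pi>)"
      unfolding marginals[symmetric] by (auto intro!: nn_integral_distr)
    have "(\<integral>\<^sup>+z. ennreal (f (snd z)) \<partial>\<pi>)
        \<le> (\<integral>\<^sup>+z. ennreal (f (fst z)) + ennreal (dist (fst z) (snd z)) \<partial>\<pi>)"
      by (intro nn_integral_mono) (simp add: nonneg f_step flip: ennreal_plus)
    moreover have "(\<integral>\<^sup>+z. ennreal (f (fst z)) \<partial>\<pi>)
        \<le> (\<integral>\<^sup>+z. ennreal (f (snd z)) + ennreal (dist (fst z) (snd z)) \<partial>\<pi>)"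
      by (intro nn_integral_mono) (simp add: nonneg f_step flip: ennreal_plus)
    ultimately show ?thesis
      by (simp add: push nn_integral_add)
  qed
  have INF_bound: "a \<le> b + transport_cost \<mu> \<nu>"
    if "\<And>\<pi>. \<pi> \<in> couplings \<mu> \<nu> \<Longrightarrow> a \<le> b + (\<integral>\<^sup>+z. ennreal (dist (fst z) (snd z)) \<partial>\<pi>)" for a b
    \<comment> \<open>Truncated subtraction moves the constant to the left, where the infimum does not see it.\<close>
  proof (cases "b = \<infinity>")
    case False
    then have "a - b \<le> transport_cost \<mu> \<nu>"
      unfolding transport_cost_def
      by (intro INF_greatest) (simp add: that ennreal_minus_le_iff)
    with False show ?thesis
      by (simp add: ennreal_minus_le_iff)
  qed simp
  show "(\<integral>\<^sup>+y. ennreal (f y) \<partial>\<nu>) \<le> (\<integral>\<^sup>+x. ennreal (f x) \<partial>\<mu>) + transport_cost \<mu> \<nu>"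
    by (rule INF_bound) (rule conjunct1[OF coupling])
  show "(\<integral>\<^sup>+x. ennreal (f x) \<partial>\<mu>) \<le> (\<integral>\<^sup>+y. ennreal (f y) \<partial>\<nu>) + transport_cost \<mu> \<nu>"
    by (rule INF_bound) (rule conjunct2[OF coupling])
qed

lemma lipschitz_on_infdist: "1-lipschitz_on UNIV (\<lambda>x. infdist x A)"
  by (rule lipschitz_onI) (simp_all add: dist_real_def infdist_triangle_abs)

section \<open>Entropy of conditional measures\<close>

lemma uniform_measure_in_borel_probs:
  assumes "\<mu> \<in> borel_probs" and "measure \<mu> C > 0"
  shows "uniform_measure \<mu> C \<in> borel_probs"
proof -
  interpret prob_space \<mu> using assms(1) by (simp add: borel_probs_def)
  show ?thesis
    using assms by (auto simp: borel_probs_def emeasure_eq_measure intro!: prob_space_uniform_measure)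
qed

text \<open>
  The density of \<open>\<mu>(\<cdot> | C)\<close> is the constant \<open>1 / \<mu>(C) \<ge> 1\<close> on \<open>C\<close>, so the logarithm in the
  entropy is almost surely the nonnegative constant \<open>- ln \<mu>(C)\<close> and the negative part vanishes.
\<close>

lemma rel_entropy_uniform_measure:
  assumes "prob_space \<mu>" and C [measurable]: "C \<in> sets \<mu>" and pos: "measure \<mu> C > 0"
  shows "rel_entropy (uniform_measure \<mu> C) \<mu> = ereal (- ln (measure \<mu> C))"
proof -
  interpret prob_space \<mu> by fact
  let ?\<nu> = "uniform_measure \<mu> C"
  let ?g = "\<lambda>x. indicator C x / emeasure \<mu> C"
  have \<nu>_def: "?\<nu> = density \<mu> ?g"
    by (simp add: uniform_measure_def)
  have prob: "prob_space ?\<nu>"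
    using pos by (intro prob_space_uniform_measure) (auto simp: emeasure_eq_measure)
  have ac: "absolutely_continuous \<mu> ?\<nu>"
    unfolding \<nu>_def by (rule absolutely_continuousI_density) measurable
  have "AE x in \<mu>. RN_deriv \<mu> ?\<nu> x = ?g x"
    using RN_deriv_unique[of ?g ?\<nu>] by (auto simp: \<nu>_def elim: eventually_mono)
  then have "AE x in ?\<nu>. RN_deriv \<mu> ?\<nu> x = ?g x"
    using absolutely_continuous_AE[OF _ ac] by auto
  moreover have "AE x in ?\<nu>. x \<in> C"
    by (rule AE_uniform_measureI) auto
  ultimately have log_density: "AE x in ?\<nu>. ln (enn2real (RN_deriv \<mu> ?\<nu> x)) = - ln (measure \<mu> C)"
  proof eventually_elim
    case (elim x)
    have "(1::ennreal) / ennreal (measure \<mu> C) = ennreal (1 / measure \<mu> C)"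
      using pos by (metis divide_ennreal ennreal_1 zero_le_one)
    with elim pos show ?case
      by (simp add: emeasure_eq_measure ln_div)
  qed
  have "(\<integral>\<^sup>+x. ennreal (ln (enn2real (RN_deriv \<mu> ?\<nu> x))) \<partial>?\<nu>)
      = (\<integral>\<^sup>+x. ennreal (- ln (measure \<mu> C)) \<partial>?\<nu>)"
    using log_density by (intro nn_integral_cong_AE) (auto elim: eventually_mono)
  moreover have "(\<integral>\<^sup>+x. ennreal (- ln (enn2real (RN_deriv \<mu> ?\<nu> x))) \<partial>?\<nu>)
      = (\<integral>\<^sup>+x. ennreal (ln (measure \<mu> C)) \<partial>?\<nu>)"
    using log_density by (intro nn_integral_cong_AE) (auto elim: eventually_mono)
  moreover have "ln (measure \<mu> C) \<le> 0"
    using pos by simp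
  ultimately show ?thesis
    using ac prob_space.emeasure_space_1[OF prob]
    by (simp add: rel_entropy_def ennreal_neg enn2ereal_ennreal zero_ennreal.rep_eq)
qed

section \<open>Deviation functions\<close>

lemma le_extend:
  assumes mono: "mono_on {0..} \<alpha>" and "0 \<le> t" and "ennreal t \<le> s"
  shows "\<alpha> t \<le> extend \<alpha> s"
proof (cases "s = \<infinity>")
  case True
  \<comment> \<open>Values at negative arguments are unconstrained, so the limit is identified with a
    supremum through a globally monotone function that agrees with \<open>\<alpha>\<close> on \<open>[0, \<infinity>)\<close>.\<close>
  define \<beta> where "\<beta> x = \<alpha> (max 0 x)" for x
  have "mono \<beta>"
    unfolding \<beta>_def by (intro monoI mono_onD[OF mono]) auto
  have "(\<beta> \<longlongrightarrow> (SUP x. \<beta> x)) at_top"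
  proof (rule order_tendstoI)
    fix a assume "a < (SUP x. \<beta> x)"
    then obtain x where "a < \<beta> x"
      by (auto simp: less_SUP_iff)
    then show "\<forall>\<^sub>F y in at_top. a < \<beta> y"
      by (intro eventually_mono[OF eventually_ge_at_top[of x]])
        (use monoD[OF \<open>mono \<beta>\<close>] in \<open>blast intro: order_less_le_trans\<close>)
  next
    fix a assume "(SUP x. \<beta> x) < a"
    then show "\<forall>\<^sub>F y in at_top. \<beta> y < a"
      by (intro always_eventually allI) (meson SUP_upper UNIV_I order.strict_trans1)
  qed
  moreover have "\<forall>\<^sub>F x in at_top. \<beta> x = \<alpha> x"
    using eventually_ge_at_top[of 0] by eventually_elim (simp add: \<beta>_def)
  ultimately have "(\<alpha> \<longlongrightarrow> (SUP x. \<beta> x)) at_top"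
    by (simp add: tendsto_cong)
  then have "Lim at_top \<alpha> = (SUP x. \<beta> x)"
    by (intro tendsto_Lim) auto
  moreover have "\<alpha> t \<le> (SUP x. \<beta> x)"
    using \<open>0 \<le> t\<close> by (intro SUP_upper2[of t]) (auto simp: \<beta>_def)
  ultimately show ?thesis
    using True by (simp add: extend_def)
next
  case False
  then have "t \<le> enn2real s"
    using assms(2,3) enn2real_mono[of "ennreal t" s] by (simp add: top.not_eq_extremum)
  with False \<open>0 \<le> t\<close> show ?thesis
    by (auto simp: extend_def intro!: mono_onD[OF mono])
qed

lemma le_gen_inverse:
  assumes mono: "mono_on {0..} \<alpha>" and "unbounded \<alpha>" and "0 \<le> t" and "\<alpha> t \<le> ennreal u"
  shows "t \<le> gen_inverse \<alpha> u"
proof -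
  obtain b where b: "0 \<le> b" "ennreal u < \<alpha> b"
    using \<open>unbounded \<alpha>\<close> unfolding unbounded_def by blast
  have "s \<le> b" if "0 \<le> s" "\<alpha> s \<le> ennreal u" for s
  proof (rule ccontr)
    assume "\<not> s \<le> b"
    then have "\<alpha> b \<le> \<alpha> s"
      using b by (intro mono_onD[OF mono]) auto
    with b that show False
      by (meson leD order_trans)
  qed
  then have "bdd_above {s. 0 \<le> s \<and> \<alpha> s \<le> ennreal u}"
    by (auto intro!: bdd_aboveI)
  with assms(3,4) show ?thesis
    unfolding gen_inverse_def by (auto intro: cSup_upper)
qed

lemma le_exp_neg:
  assumes "0 < p" and "p \<le> 1" and "a \<le> ennreal (- ln p)"
  shows "p \<le> exp_neg a"
proof -
  have "a \<noteq> \<infinity>"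
    using assms(3) by (auto simp: top_unique)
  moreover have "enn2real a \<le> - ln p"
    using assms enn2real_mono[OF assms(3)] by simp
  ultimately have "exp (ln p) \<le> exp_neg a"
    by (simp add: exp_neg_def)
  with \<open>0 < p\<close> show ?thesis
    by simp
qed

section \<open>Concentration of measure\<close>

theorem theorem6p3:
  fixes \<mu> :: "'a::polish_space measure"
    and \<alpha> :: "real \<Rightarrow> ennreal"
  assumes "\<mu> \<in> borel_probs"
    and "\<And>x\<^sub>o::'a. (\<integral>\<^sup>+x. ennreal (dist x\<^sub>o x) \<partial>\<mu>) < \<infinity>"
    and "\<alpha> \<in> class_C"
    and "unbounded \<alpha>"
    and "\<And>\<nu>. \<nu> \<in> borel_probs \<Longrightarrow> enn2ereal (extend \<alpha> (transport_cost \<mu> \<nu>)) \<le> rel_entropy \<nu> \<mu>"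
  shows "\<forall>A\<in>sets borel. measure \<mu> A > 0 \<longrightarrow>
    (let r\<^sub>A = gen_inverse \<alpha> (- ln (measure \<mu> A)) in
      \<forall>r\<ge>r\<^sub>A. measure \<mu> (enlargement A r) \<ge> 1 - exp_neg (\<alpha> (r - r\<^sub>A)))"
proof -
  interpret prob_space \<mu>
    using assms(1) by (simp add: borel_probs_def)
  have sets_\<mu>: "sets \<mu> = sets borel"
    using assms(1) by (simp add: borel_probs_def)
  then have space_\<mu>: "space \<mu> = UNIV"
    using sets_eq_imp_space_eq by fastforce
  have mono: "mono_on {0..} \<alpha>"
    using assms(3) by (simp add: class_C_def)
  have deviation: "\<alpha> t \<le> ennreal (- ln (measure \<mu> C))"
    if "C \<in> sets borel" "measure \<mu> C > 0" "0 \<le> t"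
      "ennreal t \<le> transport_cost \<mu> (uniform_measure \<mu> C)" for C t
  proof -
    have "enn2ereal (extend \<alpha> (transport_cost \<mu> (uniform_measure \<mu> C)))
        \<le> ereal (- ln (measure \<mu> C))"
      using assms(5)[OF uniform_measure_in_borel_probs[OF assms(1)]] that sets_\<mu>
      by (metis rel_entropy_uniform_measure prob_space_axioms)
    moreover have "0 \<le> - ln (measure \<mu> C)"
      using that(2) by simp
    ultimately have "extend \<alpha> (transport_cost \<mu> (uniform_measure \<mu> C)) \<le> ennreal (- ln (measure \<mu> C))"
      by (simp add: less_eq_ennreal.rep_eq enn2ereal_ennreal)
    with le_extend[OF mono that(3,4)] show ?thesis
      by (rule order_trans)
  qed
  show ?thesis
    unfolding Let_def
  proof (intro ballI impI allI)
    fix A :: "'a set" and r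
    assume A: "A \<in> sets borel" and A_pos: "measure \<mu> A > 0"
    define rA where "rA = gen_inverse \<alpha> (- ln (measure \<mu> A))"
    assume "gen_inverse \<alpha> (- ln (measure \<mu> A)) \<le> r"
    then have r: "rA \<le> r"
      by (simp add: rA_def)
    let ?f = "\<lambda>x. infdist x A"
    have [measurable]: "?f \<in> borel_measurable borel"
      by (intro borel_measurable_continuous_onI continuous_intros)
    have [measurable]: "A \<in> sets \<mu>" "?f \<in> borel_measurable \<mu>"
      using A by (simp_all add: sets_\<mu> measurable_cong_sets[OF sets_\<mu> refl])
    note transport = nn_integral_Lipschitz_le_transport_cost[OF lipschitz_on_infdist[of A] infdist_nonneg]

    obtain a where a: "a \<in> A"
      using A_pos by fastforce
    have "(\<integral>\<^sup>+x. ennreal (?f x) \<partial>\<mu>) \<le> (\<integral>\<^sup>+x. ennreal (dist a x) \<partial>\<mu>)"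
      using a by (intro nn_integral_mono ennreal_leI) (metis dist_commute infdist_le)
    then have "(\<integral>\<^sup>+x. ennreal (?f x) \<partial>\<mu>) < \<infinity>"
      using assms(2)[of a] by (rule order_le_less_trans)
    then obtain m where m: "0 \<le> m" "(\<integral>\<^sup>+x. ennreal (?f x) \<partial>\<mu>) = ennreal m"
      by (cases "\<integral>\<^sup>+x. ennreal (?f x) \<partial>\<mu>") auto

    have "AE x in uniform_measure \<mu> A. ?f x = 0"
      by (rule AE_uniform_measureI) auto
    then have "(\<integral>\<^sup>+x. ennreal (?f x) \<partial>uniform_measure \<mu> A) = (\<integral>\<^sup>+x. 0 \<partial>uniform_measure \<mu> A)"
      by (intro nn_integral_cong_AE) (auto elim: eventually_mono)
    then have "ennreal m \<le> transport_cost \<mu> (uniform_measure \<mu> A)"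
      using transport(2)[of \<mu> "uniform_measure \<mu> A"] m by simp
    then have m_le: "m \<le> rA"
      unfolding rA_def using deviation[OF A A_pos m(1)] m(1)
      by (intro le_gen_inverse[OF mono assms(4)])

    define B where "B = - enlargement A r"
    have "{x. ?f x \<le> r} \<in> sets borel"
      by measurable
    then have enl: "enlargement A r \<in> sets \<mu>"
      by (simp add: enlargement_def sets_\<mu>)
    then have B [measurable]: "B \<in> sets \<mu>"
      using sets.compl_sets[OF enl] by (simp add: B_def space_\<mu> Compl_eq_Diff_UNIV)
    have "measure \<mu> B \<le> exp_neg (\<alpha> (r - rA))"
    proof (cases "measure \<mu> B = 0")
      case True
      then show ?thesis
        by (simp add: exp_neg_def)
    next
      case False
      then have B_pos: "measure \<mu> B > 0"
        using measure_nonneg[of \<mu> B] by linarith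
      interpret \<nu>: prob_space "uniform_measure \<mu> B"
        using B_pos by (intro prob_space_uniform_measure) (auto simp: emeasure_eq_measure)
      have "AE x in uniform_measure \<mu> B. r \<le> ?f x"
        by (rule AE_uniform_measureI[OF B]) (auto simp: B_def enlargement_def)
      then have "(\<integral>\<^sup>+x. ennreal r \<partial>uniform_measure \<mu> B) \<le> (\<integral>\<^sup>+x. ennreal (?f x) \<partial>uniform_measure \<mu> B)"
        by (intro nn_integral_mono_AE) (auto elim: eventually_mono intro: ennreal_leI)
      then have "ennreal r \<le> ennreal m + transport_cost \<mu> (uniform_measure \<mu> B)"
        using transport(1)[of "uniform_measure \<mu> B" \<mu>] m(2) \<nu>.emeasure_space_1 by simp
      then have "ennreal (r - m) \<le> transport_cost \<mu> (uniform_measure \<mu> B)"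
        using m(1) by (simp add: ennreal_minus[symmetric] ennreal_minus_le_iff)
      then have "\<alpha> (r - m) \<le> ennreal (- ln (measure \<mu> B))"
        using deviation[of B "r - m"] B B_pos m_le r by (simp add: sets_\<mu>)
      moreover have "\<alpha> (r - rA) \<le> \<alpha> (r - m)"
        using m_le r by (intro mono_onD[OF mono]) auto
      ultimately show ?thesis
        using B_pos by (intro le_exp_neg) auto
    qed
    moreover have "measure \<mu> B = 1 - measure \<mu> (enlargement A r)"
      using prob_compl[OF enl] by (simp add: B_def space_\<mu> Compl_eq_Diff_UNIV)
    ultimately show "1 - exp_neg (\<alpha> (r - gen_inverse \<alpha> (- ln (measure \<mu> A))))
        \<le> measure \<mu> (enlargement A r)"
      unfolding rA_def by linarith
  qed
qed

end
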